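(* (i) Let $n_1,n_2,n_3\ge 1$ and let $\Delta_1,\Delta_2,\Delta_3$ be partitions of $\langle n_1\rangle,\langle n_2\rangle,\langle n_3\rangle$ respectively. Let $P_1\in\widehat{G}_{\Delta_1,\Delta_2}\subseteq C_{n_1,n_2}$ and $P_2\in\widehat{G}_{\Delta_2,\Delta_3}\subseteq C_{n_2,n_3}$. Then $$P_1P_2\in\widehat{G}_{\Delta_1,\Delta_3}\subseteq C_{n_1,n_3}\quad\text{and}\quad (P_1P_2)^{-+}=P_1^{-+}P_2^{-+}.$$ (ii) Let $t\ge 2$, let $n_1,\dots,n_{t+1}\ge 1$, and let $\Delta_l$ be a partition of $\langle n_l\rangle$ for $l=1,\dots,t+1$. Let $P_l\in\widehat{G}_{\Delta_l,\Delta_{l+1}}\subseteq C_{n_l,n_{l+1}}$ for $l=1,\dots,t$. Then $$P_1P_2\cdots P_t\in\widehat{G}_{\Delta_1,\Delta_{t+1}}\subseteq C_{n_1,n_{t+1}}\quad\text{and}\quad (P_1P_2\cdots P_t)^{-+}=P_1^{-+}P_2^{-+}\cdots P_t^{-+}.$$ Here each grouped matrix is taken with respect to the pair of partitions in the corresponding set: $P_l^{-+}=P_l^{-+(\Delta_l,\Delta_{l+1})}$, and the grouped matrix of the product is taken with respect to $(\Delta_1,\Delta_3)$ in (i) and $(\Delta_1,\Delta_{t+1})$ in (ii).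
   Context: For $m\ge1$, $\langle m\rangle=\{1,2,\dots,m\}$. $C_{m,n}$ is the set of complex $m\times n$ matrices. Partitions do not contain the empty set. For $P\in C_{m,n}$ and nonempty $K\subseteq\langle m\rangle$, $L\subseteq\langle n\rangle$, $P_K^L=(P_{ij})_{i\in K,j\in L}$ denotes the submatrix. A complex matrix is *generalized stochastic* if all its row sums are equal to one and the same number $a\in\mathbb{C}$ ($a=0$ allowed). For a partition $\Delta$ of $\langle m\rangle$ and a partition $\Sigma$ of $\langle n\rangle$, $P\in C_{m,n}$ is *$[\Delta]$-stable on $\Sigma$* if $P_K^L$ is generalized stochastic for all $K\in\Delta$, $L\in\Sigma$. $\widehat{G}_{\Delta,\Sigma}=\widehat{G}_{\Delta,\Sigma}(m,n)$ is the set of all $P\in C_{m,n}$ that are $[\Delta]$-stable on $\Sigma$. For $P\in\widehat{G}_{\Delta,\Sigma}$, the *grouped matrix* $P^{-+}=P^{-+(\Delta,\Sigma)}$ is the matrix with rows indexed by the sets $K\in\Delta$ and columns indexed by the sets $L\in\Sigma$, whose entry $(K,L)$ is the common value $\sum_{j\in L}P_{ij}$, $i\in K$. *)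

theory Defs
  imports
    Complex_Main
    "HOL-Library.Disjoint_Sets"
    "Jordan_Normal_Form.Matrix"
    "Jordan_Normal_Form.DL_Submatrix"
begin

text \<open>
  Rows and columns of an \<open>m \<times> n\<close> matrix are numbered from 0 in the matrix library, so the index
  set \<open>{1, \<dots>, m}\<close> is represented by \<open>{0..<m}\<close>.
\<close>

definition generalized_stochastic :: "complex mat \<Rightarrow> bool" where
  "generalized_stochastic A \<longleftrightarrow>
     (\<exists>a. \<forall>i<dim_row A. (\<Sum>j = 0..<dim_col A. A $$ (i, j)) = a)"

definition stable_on :: "nat set set \<Rightarrow> nat set set \<Rightarrow> complex mat \<Rightarrow> bool" where
  "stable_on \<Delta> \<Sigma> P \<longleftrightarrow>
     (\<forall>K\<in>\<Delta>. \<forall>L\<in>\<Sigma>. generalized_stochastic (submatrix P K L))"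

definition G_hat :: "nat \<Rightarrow> nat \<Rightarrow> nat set set \<Rightarrow> nat set set \<Rightarrow> complex mat set" where
  "G_hat m n \<Delta> \<Sigma> = {P \<in> carrier_mat m n. stable_on \<Delta> \<Sigma> P}"

text \<open>
  A matrix with rows indexed by the sets in \<open>\<Delta>\<close> and columns indexed by the sets in \<open>\<Sigma>\<close> is a
  function of two set arguments that is 0 outside \<open>\<Delta> \<times> \<Sigma>\<close>; hence two such matrices are equal
  as functions iff they agree on \<open>\<Delta> \<times> \<Sigma>\<close>.
\<close>

type_synonym block_mat = "nat set \<Rightarrow> nat set \<Rightarrow> complex"

text \<open>
  The description operator below is well defined for \<open>P \<in> G_hat m n \<Delta> \<Sigma>\<close> and partitions
  \<open>\<Delta>\<close>, \<open>\<Sigma>\<close>, since the blocks \<open>K\<close> are then nonempty.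
\<close>

definition grouped :: "nat set set \<Rightarrow> nat set set \<Rightarrow> complex mat \<Rightarrow> block_mat" where
  "grouped \<Delta> \<Sigma> P = (\<lambda>K L.
     if K \<in> \<Delta> \<and> L \<in> \<Sigma> then (THE a. \<forall>i\<in>K. (\<Sum>j\<in>L. P $$ (i, j)) = a) else 0)"

text \<open>Matrix product, where \<open>\<Sigma>\<close> indexes the columns of \<open>A\<close> and the rows of \<open>B\<close>.\<close>

definition block_mult :: "nat set set \<Rightarrow> block_mat \<Rightarrow> block_mat \<Rightarrow> block_mat" where
  "block_mult \<Sigma> A B = (\<lambda>K M. \<Sum>L\<in>\<Sigma>. A K L * B L M)"

text \<open>
  The products \<open>P 1 * P 2 * \<dots> * P t\<close> and \<open>A 1 * A 2 * \<dots> * A t\<close>, for \<open>t \<ge> 1\<close>, bracketed to the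
  left; here the columns of \<open>A l\<close> and the rows of \<open>A (l + 1)\<close> are indexed by \<open>\<Delta> (l + 1)\<close>.
\<close>

definition mat_chain :: "(nat \<Rightarrow> complex mat) \<Rightarrow> nat \<Rightarrow> complex mat" where
  "mat_chain P t = foldl (\<lambda>Q l. Q * P l) (P 1) [2..<t + 1]"

definition block_chain :: "(nat \<Rightarrow> nat set set) \<Rightarrow> (nat \<Rightarrow> block_mat) \<Rightarrow> nat \<Rightarrow> block_mat" where
  "block_chain \<Delta> A t = foldl (\<lambda>B l. block_mult (\<Delta> l) B (A l)) (A 1) [2..<t + 1]"

end

theory Submission
  imports Defs
begin

text \<open>
  Membership of \<open>P\<close> in \<open>G_hat\<close> says that, for a column block \<open>L\<close>, the partial row sum
  \<open>\<Sum>j\<in>L. P $$ (i, j)\<close> depends on the row \<open>i\<close> only through its block \<open>K\<close>, and the grouped matrix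
  records this dependence. For a product, the partial row sum over a block \<open>M\<close> is, for \<open>i \<in> K\<close>,
    \<open>\<Sum>j\<in>M. \<Sum>k<n2. P1 $$ (i, k) * P2 $$ (k, j)\<close>
    \<open>= \<Sum>L\<in>\<Delta>2. \<Sum>k\<in>L. P1 $$ (i, k) * (\<Sum>j\<in>M. P2 $$ (k, j))\<close>
    \<open>= \<Sum>L\<in>\<Delta>2. grouped \<Delta>1 \<Delta>2 P1 K L * grouped \<Delta>2 \<Delta>3 P2 L M\<close>,
  because the inner sum equals \<open>grouped \<Delta>2 \<Delta>3 P2 L M\<close> for every \<open>k \<in> L\<close> and can be taken out of
  the sum over \<open>k\<close>. The result does not depend on \<open>i \<in> K\<close>, so the product is stable, and it is
  the entry of the product of the grouped matrices. Products of several factors follow by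
  induction on their number.

  The definition of stability speaks of submatrices, whose rows and columns are renumbered by
  \<open>pick\<close>. The lemmas \<open>G_hat_row_sum\<close> and \<open>G_hat_groupedI\<close> replace it by the condition on partial
  row sums in the original numbering; the lemma \<open>G_hat_mult\<close> is the computation above.
\<close>

lemma bij_betw_pick:
  assumes "finite S"
  shows "bij_betw (pick S) {0..<card S} S"
proof -
  have inj: "inj_on (pick S) {0..<card S}"
  proof (rule linorder_inj_onI)
    fix i j
    assume "i < j" "i \<in> {0..<card S}" "j \<in> {0..<card S}"
    then show "pick S i \<noteq> pick S j"
      using pick_mono_le[of j S i] by simp
  qed auto
  have sub: "pick S ` {0..<card S} \<subseteq> S"
    using pick_in_set_le by auto
  have "pick S ` {0..<card S} = S"
    by (rule card_subset_eq[OF assms sub]) (simp add: card_image[OF inj])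
  with inj show ?thesis
    by (simp add: bij_betw_def)
qed

lemma generalized_stochastic_submatrix_iff:
  assumes K: "K \<subseteq> {0..<dim_row P}" and L: "L \<subseteq> {0..<dim_col P}"
  shows "generalized_stochastic (submatrix P K L) \<longleftrightarrow> (\<exists>a. \<forall>i\<in>K. (\<Sum>j\<in>L. P $$ (i, j)) = a)"
proof -
  have KK: "{i. i < dim_row P \<and> i \<in> K} = K" and LL: "{j. j < dim_col P \<and> j \<in> L} = L"
    using K L by auto
  have bK: "bij_betw (pick K) {0..<card K} K" and bL: "bij_betw (pick L) {0..<card L} L"
    using finite_subset[OF K] finite_subset[OF L] by (simp_all add: bij_betw_pick)
  have row: "(\<Sum>j = 0..<card L. submatrix P K L $$ (i, j)) = (\<Sum>j\<in>L. P $$ (pick K i, j))"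
    if "i < card K" for i
  proof -
    have "(\<Sum>j = 0..<card L. submatrix P K L $$ (i, j)) = (\<Sum>j = 0..<card L. P $$ (pick K i, pick L j))"
      using that by (intro sum.cong) (simp_all add: submatrix_index KK LL)
    also have "\<dots> = (\<Sum>j\<in>L. P $$ (pick K i, j))"
      by (rule sum.reindex_bij_betw[OF bL])
    finally show ?thesis .
  qed
  have "generalized_stochastic (submatrix P K L) \<longleftrightarrow>
          (\<exists>a. \<forall>i\<in>{0..<card K}. (\<Sum>j\<in>L. P $$ (pick K i, j)) = a)"
    by (simp add: generalized_stochastic_def dim_submatrix KK LL row Ball_def)
  also have "\<dots> \<longleftrightarrow> (\<exists>a. \<forall>i\<in>pick K ` {0..<card K}. (\<Sum>j\<in>L. P $$ (i, j)) = a)"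
    by simp
  also have "pick K ` {0..<card K} = K"
    using bK by (simp add: bij_betw_def)
  finally show ?thesis .
qed

lemma partition_on_subset:
  assumes "partition_on A \<Delta>" "K \<in> \<Delta>"
  shows "K \<subseteq> A"
  using assms by (auto simp: partition_on_def)

lemma stable_on_iff_row_sums:
  assumes "P \<in> carrier_mat m n" "partition_on {0..<m} \<Delta>" "partition_on {0..<n} \<Sigma>"
  shows "stable_on \<Delta> \<Sigma> P \<longleftrightarrow>
           (\<forall>K\<in>\<Delta>. \<forall>L\<in>\<Sigma>. \<exists>a. \<forall>i\<in>K. (\<Sum>j\<in>L. P $$ (i, j)) = a)"
proof -
  have "K \<subseteq> {0..<dim_row P}" if "K \<in> \<Delta>" for K
    using partition_on_subset[OF assms(2) that] assms(1) by simp
  moreover have "L \<subseteq> {0..<dim_col P}" if "L \<in> \<Sigma>" for L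
    using partition_on_subset[OF assms(3) that] assms(1) by simp
  ultimately show ?thesis
    unfolding stable_on_def by (simp add: generalized_stochastic_submatrix_iff)
qed

text \<open>
  A block \<open>K\<close> of a partition is nonempty, so a condition on all its rows determines the common
  value that the description operator in \<open>grouped\<close> refers to.
\<close>

lemma grouped_eqI:
  assumes "partition_on A \<Delta>" "K \<in> \<Delta>" "L \<in> \<Sigma>" "\<And>i. i \<in> K \<Longrightarrow> (\<Sum>j\<in>L. P $$ (i, j)) = a"
  shows "grouped \<Delta> \<Sigma> P K L = a"
proof -
  obtain i where i: "i \<in> K"
    using assms partition_onD3 by (metis ex_in_conv)
  have "(THE a. \<forall>i\<in>K. (\<Sum>j\<in>L. P $$ (i, j)) = a) = a"
    by (rule the_equality) (use assms(4) i in auto)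
  then show ?thesis
    using assms by (simp add: grouped_def)
qed

lemma G_hat_row_sum:
  assumes "partition_on {0..<m} \<Delta>" "partition_on {0..<n} \<Sigma>" "P \<in> G_hat m n \<Delta> \<Sigma>"
    and "K \<in> \<Delta>" "L \<in> \<Sigma>" "i \<in> K"
  shows "(\<Sum>j\<in>L. P $$ (i, j)) = grouped \<Delta> \<Sigma> P K L"
proof -
  have "P \<in> carrier_mat m n" "stable_on \<Delta> \<Sigma> P"
    using assms(3) by (simp_all add: G_hat_def)
  then have "\<forall>K\<in>\<Delta>. \<forall>L\<in>\<Sigma>. \<exists>a. \<forall>i\<in>K. (\<Sum>j\<in>L. P $$ (i, j)) = a"
    using stable_on_iff_row_sums assms(1,2) by simp
  then obtain a where a: "\<forall>i\<in>K. (\<Sum>j\<in>L. P $$ (i, j)) = a"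
    using assms(4,5) by meson
  then have "grouped \<Delta> \<Sigma> P K L = a"
    using assms by (intro grouped_eqI) auto
  with a assms show ?thesis
    by simp
qed

text \<open>
  The converse of the preceding lemma: any block matrix that gives the partial row sums certifies
  stability and is the grouped matrix. It has to vanish outside \<open>\<Delta> \<times> \<Sigma>\<close>, as \<open>grouped\<close> does.
\<close>

lemma G_hat_groupedI:
  assumes "partition_on {0..<m} \<Delta>" "partition_on {0..<n} \<Sigma>" "P \<in> carrier_mat m n"
    and row: "\<And>K L i. K \<in> \<Delta> \<Longrightarrow> L \<in> \<Sigma> \<Longrightarrow> i \<in> K \<Longrightarrow> (\<Sum>j\<in>L. P $$ (i, j)) = B K L"
    and outside: "\<And>K L. \<not> (K \<in> \<Delta> \<and> L \<in> \<Sigma>) \<Longrightarrow> B K L = 0"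
  shows "P \<in> G_hat m n \<Delta> \<Sigma>" and "grouped \<Delta> \<Sigma> P = B"
proof -
  show "P \<in> G_hat m n \<Delta> \<Sigma>"
    using assms by (auto simp: G_hat_def stable_on_iff_row_sums)
  show "grouped \<Delta> \<Sigma> P = B"
  proof (intro ext)
    fix K L
    show "grouped \<Delta> \<Sigma> P K L = B K L"
    proof (cases "K \<in> \<Delta> \<and> L \<in> \<Sigma>")
      case True
      then show ?thesis
        using assms(1) row by (intro grouped_eqI) auto
    next
      case False
      then show ?thesis
        using outside by (auto simp: grouped_def)
    qed
  qed
qed

lemma sum_partition_on:
  assumes "finite A" "partition_on A \<Delta>"
  shows "(\<Sum>k\<in>A. f k) = (\<Sum>L\<in>\<Delta>. \<Sum>k\<in>L. f k)"
proof -
  have "(\<Sum>k\<in>\<Union>\<Delta>. f k) = (\<Sum>L\<in>\<Delta>. \<Sum>k\<in>L. f k)"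
    using assms by (subst sum.Union_disjoint_sets)
      (auto simp: partition_on_def dest: finite_subset[OF Union_upper])
  then show ?thesis
    using assms by (simp add: partition_on_def)
qed

lemma G_hat_mult:
  assumes \<Delta>1: "partition_on {0..<n1} \<Delta>1" and \<Delta>2: "partition_on {0..<n2} \<Delta>2"
    and \<Delta>3: "partition_on {0..<n3} \<Delta>3"
    and P1: "P1 \<in> G_hat n1 n2 \<Delta>1 \<Delta>2" and P2: "P2 \<in> G_hat n2 n3 \<Delta>2 \<Delta>3"
  shows "P1 * P2 \<in> G_hat n1 n3 \<Delta>1 \<Delta>3"
    and "grouped \<Delta>1 \<Delta>3 (P1 * P2) = block_mult \<Delta>2 (grouped \<Delta>1 \<Delta>2 P1) (grouped \<Delta>2 \<Delta>3 P2)"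
proof -
  let ?A = "grouped \<Delta>1 \<Delta>2 P1" and ?B = "grouped \<Delta>2 \<Delta>3 P2"
  have c1: "P1 \<in> carrier_mat n1 n2" and c2: "P2 \<in> carrier_mat n2 n3"
    using P1 P2 by (auto simp: G_hat_def)
  have row: "(\<Sum>j\<in>M. (P1 * P2) $$ (i, j)) = block_mult \<Delta>2 ?A ?B K M"
    if K: "K \<in> \<Delta>1" and M: "M \<in> \<Delta>3" and i: "i \<in> K" for K M i
  proof -
    have "i < n1"
      using partition_on_subset[OF \<Delta>1 K] i by auto
    moreover have "j < n3" if "j \<in> M" for j
      using partition_on_subset[OF \<Delta>3 M] that by auto
    ultimately have "(\<Sum>j\<in>M. (P1 * P2) $$ (i, j)) =
        (\<Sum>j\<in>M. \<Sum>k = 0..<n2. P1 $$ (i, k) * P2 $$ (k, j))"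
      using c1 c2 by (intro sum.cong) (simp_all add: scalar_prod_def)
    also have "\<dots> = (\<Sum>k = 0..<n2. P1 $$ (i, k) * (\<Sum>j\<in>M. P2 $$ (k, j)))"
      by (subst sum.swap) (simp add: sum_distrib_left)
    also have "\<dots> = (\<Sum>L\<in>\<Delta>2. \<Sum>k\<in>L. P1 $$ (i, k) * (\<Sum>j\<in>M. P2 $$ (k, j)))"
      by (rule sum_partition_on[OF _ \<Delta>2]) simp
    also have "\<dots> = (\<Sum>L\<in>\<Delta>2. \<Sum>k\<in>L. P1 $$ (i, k) * ?B L M)"
      by (intro sum.cong refl) (simp add: G_hat_row_sum[OF \<Delta>2 \<Delta>3 P2 _ M])
    also have "\<dots> = (\<Sum>L\<in>\<Delta>2. ?A K L * ?B L M)"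
      by (intro sum.cong refl) (simp add: G_hat_row_sum[OF \<Delta>1 \<Delta>2 P1 K _ i] flip: sum_distrib_right)
    finally show ?thesis
      by (simp add: block_mult_def)
  qed
  have outside: "block_mult \<Delta>2 ?A ?B K M = 0" if "\<not> (K \<in> \<Delta>1 \<and> M \<in> \<Delta>3)" for K M
    using that by (auto simp: block_mult_def grouped_def intro!: sum.neutral)
  have c: "P1 * P2 \<in> carrier_mat n1 n3"
    using c1 c2 by simp
  show "P1 * P2 \<in> G_hat n1 n3 \<Delta>1 \<Delta>3"
    and "grouped \<Delta>1 \<Delta>3 (P1 * P2) = block_mult \<Delta>2 ?A ?B"
    using G_hat_groupedI[OF \<Delta>1 \<Delta>3 c row outside] by auto
qed

lemma mat_chain_1: "mat_chain P (Suc 0) = P 1"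
  by (simp add: mat_chain_def)

lemma mat_chain_Suc: "1 \<le> t \<Longrightarrow> mat_chain P (Suc t) = mat_chain P t * P (Suc t)"
  by (simp add: mat_chain_def)

lemma block_chain_1: "block_chain \<Delta> A (Suc 0) = A 1"
  by (simp add: block_chain_def)

lemma block_chain_Suc:
  "1 \<le> t \<Longrightarrow> block_chain \<Delta> A (Suc t) = block_mult (\<Delta> (Suc t)) (block_chain \<Delta> A t) (A (Suc t))"
  by (simp add: block_chain_def)

lemma G_hat_mat_chain:
  assumes "1 \<le> t"
    and "\<And>l. l \<in> {1..t + 1} \<Longrightarrow> partition_on {0..<n l} (\<Delta> l)"
    and "\<And>l. l \<in> {1..t} \<Longrightarrow> P l \<in> G_hat (n l) (n (l + 1)) (\<Delta> l) (\<Delta> (l + 1))"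
  shows "mat_chain P t \<in> G_hat (n 1) (n (t + 1)) (\<Delta> 1) (\<Delta> (t + 1)) \<and>
         grouped (\<Delta> 1) (\<Delta> (t + 1)) (mat_chain P t) =
           block_chain \<Delta> (\<lambda>l. grouped (\<Delta> l) (\<Delta> (l + 1)) (P l)) t"
  using assms
proof (induction t rule: nat_induct_at_least)
  case base
  then show ?case
    using base(2)[of 1] by (simp add: mat_chain_1 block_chain_1)
next
  case (Suc t)
  have IH: "mat_chain P t \<in> G_hat (n 1) (n (t + 1)) (\<Delta> 1) (\<Delta> (t + 1))"
      "grouped (\<Delta> 1) (\<Delta> (t + 1)) (mat_chain P t) =
        block_chain \<Delta> (\<lambda>l. grouped (\<Delta> l) (\<Delta> (l + 1)) (P l)) t"
    using Suc by auto
  have parts: "partition_on {0..<n 1} (\<Delta> 1)" "partition_on {0..<n (t + 1)} (\<Delta> (t + 1))"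
      "partition_on {0..<n (t + 2)} (\<Delta> (t + 2))"
    using Suc.prems(1) by auto
  have last: "P (t + 1) \<in> G_hat (n (t + 1)) (n (t + 2)) (\<Delta> (t + 1)) (\<Delta> (t + 2))"
    using Suc.prems(2)[of "t + 1"] by simp
  show ?case
    using G_hat_mult[OF parts IH(1) last] IH(2) Suc.hyps
    by (simp add: mat_chain_Suc block_chain_Suc)
qed

theorem theorem1p9:
  shows "(\<forall>(n1::nat) (n2::nat) (n3::nat) \<Delta>1 \<Delta>2 \<Delta>3 P1 P2.
            1 \<le> n1 \<and> 1 \<le> n2 \<and> 1 \<le> n3 \<and>
            partition_on {0..<n1} \<Delta>1 \<and> partition_on {0..<n2} \<Delta>2 \<and> partition_on {0..<n3} \<Delta>3 \<and>
            P1 \<in> G_hat n1 n2 \<Delta>1 \<Delta>2 \<and> P2 \<in> G_hat n2 n3 \<Delta>2 \<Delta>3 \<longrightarrow>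
              P1 * P2 \<in> G_hat n1 n3 \<Delta>1 \<Delta>3 \<and>
              grouped \<Delta>1 \<Delta>3 (P1 * P2) = block_mult \<Delta>2 (grouped \<Delta>1 \<Delta>2 P1) (grouped \<Delta>2 \<Delta>3 P2))
       \<and> (\<forall>(t::nat) (n :: nat \<Rightarrow> nat) \<Delta> P.
            2 \<le> t \<and>
            (\<forall>l\<in>{1..t + 1}. 1 \<le> n l \<and> partition_on {0..<n l} (\<Delta> l)) \<and>
            (\<forall>l\<in>{1..t}. P l \<in> G_hat (n l) (n (l + 1)) (\<Delta> l) (\<Delta> (l + 1))) \<longrightarrow>
              mat_chain P t \<in> G_hat (n 1) (n (t + 1)) (\<Delta> 1) (\<Delta> (t + 1)) \<and>
              grouped (\<Delta> 1) (\<Delta> (t + 1)) (mat_chain P t) =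
                block_chain \<Delta> (\<lambda>l. grouped (\<Delta> l) (\<Delta> (l + 1)) (P l)) t)"
proof (intro conjI allI impI; elim conjE)
  fix n1 n2 n3 :: nat and \<Delta>1 \<Delta>2 \<Delta>3 P1 P2
  assume "partition_on {0..<n1} \<Delta>1" "partition_on {0..<n2} \<Delta>2" "partition_on {0..<n3} \<Delta>3"
    "P1 \<in> G_hat n1 n2 \<Delta>1 \<Delta>2" "P2 \<in> G_hat n2 n3 \<Delta>2 \<Delta>3"
  note mult = G_hat_mult[OF this]
  show "P1 * P2 \<in> G_hat n1 n3 \<Delta>1 \<Delta>3"
    by (rule mult)
  show "grouped \<Delta>1 \<Delta>3 (P1 * P2) = block_mult \<Delta>2 (grouped \<Delta>1 \<Delta>2 P1) (grouped \<Delta>2 \<Delta>3 P2)"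
    by (rule mult)
next
  fix t :: nat and n :: "nat \<Rightarrow> nat" and \<Delta> P
  assume "2 \<le> t" "\<forall>l\<in>{1..t + 1}. 1 \<le> n l \<and> partition_on {0..<n l} (\<Delta> l)"
    "\<forall>l\<in>{1..t}. P l \<in> G_hat (n l) (n (l + 1)) (\<Delta> l) (\<Delta> (l + 1))"
  then have chain: "mat_chain P t \<in> G_hat (n 1) (n (t + 1)) (\<Delta> 1) (\<Delta> (t + 1)) \<and>
      grouped (\<Delta> 1) (\<Delta> (t + 1)) (mat_chain P t) =
        block_chain \<Delta> (\<lambda>l. grouped (\<Delta> l) (\<Delta> (l + 1)) (P l)) t"
    by (intro G_hat_mat_chain) auto
  show "mat_chain P t \<in> G_hat (n 1) (n (t + 1)) (\<Delta> 1) (\<Delta> (t + 1))"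
    using chain by (rule conjunct1)
  show "grouped (\<Delta> 1) (\<Delta> (t + 1)) (mat_chain P t) =
      block_chain \<Delta> (\<lambda>l. grouped (\<Delta> l) (\<Delta> (l + 1)) (P l)) t"
    using chain by (rule conjunct2)
qed

end
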